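(* Let $a>-\tfrac12$ be a real number with $a\neq 0$. For each integer $n\ge 0$ let $C_n^{(a)}(x)$ be the Gegenbauer polynomial and put $$\gamma_{n}(a) = \int_{-1}^{1} \left[ \frac{C_{n}^{(a)}(x) - C_{n}^{(a)}(0)}{x} \right]^{2} (1-x^2)^{a-1/2}\, dx .$$ Then, for odd index, $$\gamma_{2n+1}(a) = \frac{\pi\, \Gamma(2a+2n+1)}{2^{2a-2}\, (2n+1)!\, \Gamma(a)^{2}}\qquad (n\ge 0),$$ and, for even index, $$\gamma_{2n}(a) = \frac{\pi\, \Gamma(2a)\, \Gamma(a+n)}{2^{2a-3}\, \Gamma(2n+1)\, \Gamma(a)^{3}}\, X_{n}(a)\qquad (n\ge 1),$$ where $X_n(a)$ is the polynomial $$X_{n}(a) = 2^{2n-1} \left( a + \tfrac{1}{2} \right)_{n} - \binom{2n-1}{n-1} (a)_{n}.$$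
   Context: The Gegenbauer polynomials $C_n^{(a)}(x)$ (also written $C_n^a(x)$) are defined by $C_0^{(a)}(x)=1$, $C_1^{(a)}(x)=2ax$ and $C_{n}^{(a)}(x) = \frac{1}{n}\left[ 2x(n+a-1) C_{n-1}^{(a)}(x) - (n+2a-2) C_{n-2}^{(a)}(x) \right]$ for $n\ge 2$. The Pochhammer symbol is $(z)_n=z(z+1)\cdots(z+n-1)$, with $(z)_0=1$. *)

theory Defs
  imports "HOL-Analysis.Analysis"
begin

fun gegenbauer :: "nat \<Rightarrow> real \<Rightarrow> real \<Rightarrow> real" where
  "gegenbauer 0 a x = 1"
| "gegenbauer (Suc 0) a x = 2 * a * x"
| "gegenbauer (Suc (Suc k)) a x =
     (let n = real (Suc (Suc k)) in
        1 / n * (2 * x * (n + a - 1) * gegenbauer (Suc k) a x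
                 - (n + 2 * a - 2) * gegenbauer k a x))"

text \<open>
  The integrand takes the conventional value \<open>0\<close> at \<open>x = 0\<close> (division by zero) and at \<open>x = 1\<close>,
  \<open>x = -1\<close> (base \<open>0\<close> of \<open>powr\<close>); these three points do not affect the integral.  For
  \<open>-1/2 < a < 1/2\<close> the weight is unbounded at the end points.  The integrand is
  nonnegative, so the Henstock-Kurzweil integral used here agrees with the Lebesgue one.
\<close>

definition gegenbauer_gamma :: "nat \<Rightarrow> real \<Rightarrow> real" where
  "gegenbauer_gamma n a =
     integral {-1..1}
       (\<lambda>x. ((gegenbauer n a x - gegenbauer n a 0) / x)\<^sup>2 * (1 - x\<^sup>2) powr (a - 1/2))"

text \<open>Only meant for \<open>n \<ge> 1\<close>: the subtractions below are on natural numbers.\<close>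

definition gegenbauer_X :: "nat \<Rightarrow> real \<Rightarrow> real" where
  "gegenbauer_X n a =
     2 ^ (2 * n - 1) * pochhammer (a + 1/2) n
     - real ((2 * n - 1) choose (n - 1)) * pochhammer a n"

end

theory Submission
  imports Defs
begin

text \<open>
  Write \<open>C\<^sub>n\<close> for the Gegenbauer polynomial, \<open>w(x) = (1 - x\<^sup>2) powr (a - 1/2)\<close> for its weight,
  \<open>L f\<close> for the integral of \<open>f w\<close> over \<open>[-1, 1]\<close>, and \<open>h\<^sub>n = L (C\<^sub>n\<^sup>2)\<close>.

  Subtracting from the three-term recurrence its own value at \<open>0\<close> and dividing by \<open>x\<close> shows that the
  polynomials \<open>q\<^sub>n = (C\<^sub>n - C\<^sub>n(0)) / x\<close> satisfy
  \<open>(n + 2) q\<^bsub>n+2\<^esub> = 2 (n + 1 + a) C\<^bsub>n+1\<^esub> - (n + 2 a) q\<^sub>n\<close>.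
  Since \<open>q\<^sub>n\<close> has degree less than \<open>n\<close>, it is orthogonal to \<open>C\<^bsub>n+1\<^esub>\<close>. Squaring and integrating
  therefore leaves a recurrence of first order, in steps of two, for \<open>\<gamma>\<^sub>n = L (q\<^sub>n\<^sup>2)\<close>:
  \<open>(n + 2)\<^sup>2 \<gamma>\<^bsub>n+2\<^esub> = 4 (n + 1 + a)\<^sup>2 h\<^bsub>n+1\<^esub> + (n + 2 a)\<^sup>2 \<gamma>\<^sub>n\<close>  (\<open>gegenbauer_gamma_rec\<close>).
  Once \<open>h\<^sub>n\<close> is known, both closed forms follow by induction; in the even case the recurrence
  for \<open>\<gamma>\<close> becomes a recurrence for \<open>X\<^sub>n(a)\<close> (\<open>gegenbauer_X_rec\<close>).

  What remains is the orthogonality of the \<open>C\<^sub>n\<close> and the value of \<open>h\<^sub>n\<close>. A three-term recurrence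
  turns \<open>L C\<^sub>n = 0\<close> for all \<open>n \<ge> 1\<close> into full orthogonality (\<open>gegenbauer_orthogonal\<close>) and
  determines the quotients \<open>h\<^bsub>n+1\<^esub> / h\<^sub>n\<close> (\<open>gegenbauer_norm_rec\<close>). The vanishing of \<open>L C\<^sub>n\<close> comes from
  the derivative of \<open>(1 - x\<^sup>2) powr (a + 1/2) * C\<^sub>n(x)\<close>, a function that is zero at both end points.
  Finally \<open>h\<^sub>0 = L 1\<close> is a Beta integral. The Gamma function enters only through \<open>L 1\<close> and in the last
  step; everything between is stated with Pochhammer symbols and the common factor \<open>a * L 1\<close>.
\<close>

section \<open>The recurrence and the derivative\<close>

lemma gegenbauer_rec:
  "(real n + 2) * gegenbauer (n + 2) a x =
     2 * (real n + 1 + a) * x * gegenbauer (n + 1) a x - (real n + 2 * a) * gegenbauer n a x"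
  by (simp add: Let_def field_simps)

lemma gegenbauer_1: "gegenbauer 1 a x = 2 * a * x"
  by simp

declare gegenbauer.simps(3) [simp del]

lemma mult_x_gegenbauer:
  "2 * (real n + 1 + a) * (x * gegenbauer (n + 1) a x) =
     (real n + 2) * gegenbauer (n + 2) a x + (real n + 2 * a) * gegenbauer n a x"
  using gegenbauer_rec[of n a x] by (simp add: algebra_simps)

lemma gegenbauer_Suc_Suc:
  "gegenbauer (n + 2) a x =
     (2 * (real n + 1 + a) * (x * gegenbauer (n + 1) a x) - (real n + 2 * a) * gegenbauer n a x)
       / (real n + 2)"
  using gegenbauer_rec[of n a x] by (simp add: field_simps)

text \<open>
  The right-hand side involves the index \<open>n + 1\<close> and not \<open>n - 1\<close>, so that the identity also makes
  sense at \<open>n = 0\<close>. It stays true when the recurrence is differentiated: modulo the recurrence both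
  sides are combinations of \<open>C\<^bsub>n+1\<^esub>\<close> and \<open>C\<^bsub>n+2\<^esub>\<close> with the same coefficients.
\<close>

lemma gegenbauer_has_derivative:
  assumes "\<bar>x\<bar> < 1"
  shows "\<exists>D. (gegenbauer n a has_real_derivative D) (at x) \<and>
             (1 - x\<^sup>2) * D = (real n + 2 * a) * (x * gegenbauer n a x)
                              - (real n + 1) * gegenbauer (n + 1) a x"
proof (induction n rule: induct_nat_012)
  case 0
  have "(gegenbauer 0 a has_real_derivative 0) (at x)"
    unfolding gegenbauer.simps(1) [abs_def] by simp
  then show ?case by (intro exI[of _ 0]) simp
next
  case 1
  have "(gegenbauer 1 a has_real_derivative 2 * a) (at x)"
    unfolding gegenbauer_1 [abs_def] by (auto intro!: derivative_eq_intros)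
  moreover have "(1 - x\<^sup>2) * (2 * a) = (real 1 + 2 * a) * (x * gegenbauer 1 a x)
                              - (real 1 + 1) * gegenbauer (1 + 1) a x"
    using gegenbauer_rec[of 0 a x] by (simp add: algebra_simps power2_eq_square)
  ultimately show ?case unfolding One_nat_def by blast
next
  case (ge2 n)
  from ge2(1) obtain D0 where
    D0: "(gegenbauer n a has_real_derivative D0) (at x)" and
    E0: "(1 - x\<^sup>2) * D0 = (real n + 2 * a) * (x * gegenbauer n a x)
                           - (real n + 1) * gegenbauer (n + 1) a x"
    by blast
  from ge2(2) obtain D1 where
    D1: "(gegenbauer (n + 1) a has_real_derivative D1) (at x)" and
    "(1 - x\<^sup>2) * D1 = (real (n + 1) + 2 * a) * (x * gegenbauer (n + 1) a x)
                           - (real (n + 1) + 1) * gegenbauer (n + 1 + 1) a x"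
    unfolding Suc_eq_plus1 by blast
  then have
    E1: "(1 - x\<^sup>2) * D1 = (real n + 1 + 2 * a) * (x * gegenbauer (n + 1) a x)
                           - (real n + 2) * gegenbauer (n + 2) a x"
    by (simp add: add_ac)
  define D2 where "D2 = (2 * (real n + 1 + a) * (1 * gegenbauer (n + 1) a x + D1 * x)
                         - (real n + 2 * a) * D0) / (real n + 2)"
  have "(gegenbauer (n + 2) a has_real_derivative D2) (at x)"
    unfolding gegenbauer_Suc_Suc [abs_def] D2_def
    by (rule DERIV_cdivide[OF DERIV_diff[OF DERIV_cmult[OF DERIV_mult[OF DERIV_ident D1]]
              DERIV_cmult[OF D0]]])
  moreover have "(1 - x\<^sup>2) * D2 = (real n + 2 + 2 * a) * (x * gegenbauer (n + 2) a x)
                           - (real n + 3) * gegenbauer (n + 3) a x"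
  proof -
    have r0: "(real n + 2 * a) * gegenbauer n a x =
       2 * (real n + 1 + a) * x * gegenbauer (n + 1) a x - (real n + 2) * gegenbauer (n + 2) a x"
      using gegenbauer_rec[of n a x] by simp
    have r1: "(real n + 3) * gegenbauer (n + 3) a x =
       2 * (real n + 2 + a) * x * gegenbauer (n + 2) a x
         - (real n + 1 + 2 * a) * gegenbauer (n + 1) a x"
      using gegenbauer_rec[of "n + 1" a x] by (simp add: algebra_simps numeral_3_eq_3)
    have d2: "(real n + 2) * D2 = 2 * (real n + 1 + a) * (gegenbauer (n + 1) a x + x * D1)
                         - (real n + 2 * a) * D0"
      unfolding D2_def by (simp add: field_simps)
    have "(real n + 2) * ((1 - x\<^sup>2) * D2) =
        2 * (real n + 1 + a) * ((1 - x\<^sup>2) * gegenbauer (n + 1) a x + x * ((1 - x\<^sup>2) * D1))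
          - (real n + 2 * a) * ((1 - x\<^sup>2) * D0)"
      using d2 by algebra
    also have "\<dots> = (real n + 2) * ((real n + 2 + 2 * a) * (x * gegenbauer (n + 2) a x)
                           - (real n + 3) * gegenbauer (n + 3) a x)"
      unfolding E0 E1 using r0 r1 by algebra
    finally show ?thesis by (simp add: add_pos_pos)
  qed
  ultimately show ?case
    by (intro exI[of _ D2]) (simp add: numeral_3_eq_3 add_ac)
qed

lemma continuous_on_gegenbauer [continuous_intros]: "continuous_on S (gegenbauer n a)"
proof (induction n rule: induct_nat_012)
  case (ge2 n)
  have "continuous_on S (gegenbauer (n + 2) a)"
    unfolding gegenbauer_Suc_Suc [abs_def]
    using ge2 by (intro continuous_intros) auto
  then show ?case by simp
qed (auto intro!: continuous_intros)

section \<open>The weighted integral\<close>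

definition gegenbauer_integral :: "real \<Rightarrow> (real \<Rightarrow> real) \<Rightarrow> real" where
  "gegenbauer_integral a f = integral {-1..1} (\<lambda>x. f x * (1 - x\<^sup>2) powr (a - 1/2))"

text \<open>
  The factorization \<open>1 - x\<^sup>2 = 4 t (1 - t)\<close> for \<open>t = (x + 1) / 2\<close> turns the weight into the
  integrand of a symmetric Beta integral. This is also where integrability comes from, as the weight is
  unbounded when \<open>a < 1/2\<close>.
\<close>

lemma weight_has_integral:
  fixes a :: real
  assumes "a > - 1/2"
  shows "((\<lambda>x. (1 - x\<^sup>2) powr (a - 1/2)) has_integral 2 powr (2 * a) * Beta (a + 1/2) (a + 1/2))
           {-1..1}"
proof -
  have "((\<lambda>t. t powr (a - 1/2) * (1 - t) powr (a - 1/2)) has_integral Beta (a + 1/2) (a + 1/2))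
          (cbox 0 1)"
    using has_integral_Beta_real[of "a + 1/2" "a + 1/2"] assms by (simp add: add_diff_eq)
  from has_integral_affinity'[OF this, of "1/2" "1/2"]
  have "((\<lambda>x. ((x + 1)/2) powr (a - 1/2) * (1 - (x + 1)/2) powr (a - 1/2))
          has_integral 2 * Beta (a + 1/2) (a + 1/2)) {-1..1}"
    by (simp add: add_divide_distrib mult.commute)
  from has_integral_mult_right[OF this, of "4 powr (a - 1/2)"]
  have I: "((\<lambda>x. 4 powr (a - 1/2) * (((x + 1)/2) powr (a - 1/2) * (1 - (x + 1)/2) powr (a - 1/2)))
          has_integral 4 powr (a - 1/2) * (2 * Beta (a + 1/2) (a + 1/2))) {-1..1}" .
  have c: "4 powr (a - 1/2) * 2 = (2::real) powr (2 * a)"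
  proof -
    have "(4::real) powr (a - 1/2) = (2 powr 2) powr (a - 1/2)" by simp
    also have "\<dots> = 2 powr (2 * (a - 1/2))" by (simp only: powr_powr)
    also have "2 * (a - 1/2) = 2 * a - 1" by simp
    finally show ?thesis by (simp add: powr_diff)
  qed
  have *: "(4 * (u * v)) powr b = 4 powr b * (u powr b * v powr b)" if "u \<ge> 0" "v \<ge> 0"
    for u v b :: real
    using that by (simp add: powr_mult)
  have "4 powr (a - 1/2) * (((x + 1)/2) powr (a - 1/2) * (1 - (x + 1)/2) powr (a - 1/2))
          = (1 - x\<^sup>2) powr (a - 1/2)" if "x \<in> {-1..1}" for x :: real
  proof -
    have "4 powr (a - 1/2) * (((x + 1)/2) powr (a - 1/2) * (1 - (x + 1)/2) powr (a - 1/2))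
        = (4 * ((x + 1)/2 * (1 - (x + 1)/2))) powr (a - 1/2)"
      using that by (intro *[symmetric]) auto
    also have "4 * ((x + 1)/2 * (1 - (x + 1)/2)) = 1 - x\<^sup>2"
      by (simp add: field_simps power2_eq_square)
    finally show ?thesis .
  qed
  from has_integral_eq[OF this I] show ?thesis
    using c by (simp add: mult.assoc[symmetric])
qed

lemma weighted_integrable:
  fixes a :: real
  assumes "a > - 1/2" and "continuous_on {-1..1} f"
  shows "(\<lambda>x. f x * (1 - x\<^sup>2) powr (a - 1/2)) integrable_on {-1..1}"
proof -
  have "(\<lambda>x. (1 - x\<^sup>2) powr (a - 1/2)) absolutely_integrable_on {-1..1}"
    using weight_has_integral[OF assms(1)]
    by (intro nonnegative_absolutely_integrable_1) (auto simp: integrable_on_def)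
  moreover have "f \<in> borel_measurable (lebesgue_on {-1..1})"
    using assms(2) by (intro continuous_imp_measurable_on_sets_lebesgue) auto
  moreover have "bounded (f ` {-1..1})"
    using assms(2) by (intro compact_imp_bounded compact_continuous_image) auto
  ultimately have "(\<lambda>x. f x * (1 - x\<^sup>2) powr (a - 1/2)) absolutely_integrable_on {-1..1}"
    by (intro absolutely_integrable_bounded_measurable_product_real) auto
  then show ?thesis by (rule set_lebesgue_integral_eq_integral(1))
qed

lemma gegenbauer_integral_add:
  fixes a :: real
  assumes "a > - 1/2" "continuous_on {-1..1} f" "continuous_on {-1..1} g"
  shows "gegenbauer_integral a (\<lambda>x. f x + g x) = gegenbauer_integral a f + gegenbauer_integral a g"
  unfolding gegenbauer_integral_def
  using integral_add[OF weighted_integrable[OF assms(1,2)] weighted_integrable[OF assms(1,3)]]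
  by (simp add: distrib_right)

lemma gegenbauer_integral_cmult:
  "gegenbauer_integral a (\<lambda>x. c * f x) = c * gegenbauer_integral a f"
  unfolding gegenbauer_integral_def by (simp add: mult.assoc)

lemma gegenbauer_integral_lincomb:
  fixes a :: real
  assumes "a > - 1/2" "continuous_on {-1..1} f" "continuous_on {-1..1} g"
  shows "gegenbauer_integral a (\<lambda>x. c * f x + d * g x) =
           c * gegenbauer_integral a f + d * gegenbauer_integral a g"
  using assms
  by (simp add: gegenbauer_integral_add gegenbauer_integral_cmult continuous_on_mult_left)

lemma gegenbauer_parameter_poles:
  fixes a :: real
  assumes "a > - 1/2" "a \<noteq> 0"
  shows "a \<notin> \<int>\<^sub>\<le>\<^sub>0" "2 * a \<notin> \<int>\<^sub>\<le>\<^sub>0" "a + 1/2 \<notin> \<int>\<^sub>\<le>\<^sub>0"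
proof -
  have *: "x \<notin> \<int>\<^sub>\<le>\<^sub>0" if "x > -1" "x \<noteq> 0" for x :: real
    using that by (auto elim!: nonpos_Ints_cases)
  show "a \<notin> \<int>\<^sub>\<le>\<^sub>0" "2 * a \<notin> \<int>\<^sub>\<le>\<^sub>0" "a + 1/2 \<notin> \<int>\<^sub>\<le>\<^sub>0"
    by (rule *; use assms in simp)+
qed

lemma Gamma_legendre_duplication_real:
  fixes z :: real
  assumes "z \<notin> \<int>\<^sub>\<le>\<^sub>0" "z + 1/2 \<notin> \<int>\<^sub>\<le>\<^sub>0"
  shows "Gamma z * Gamma (z + 1/2) = 2 powr (1 - 2 * z) * sqrt pi * Gamma (2 * z)"
proof -
  have p: "complex_of_real z \<notin> \<int>\<^sub>\<le>\<^sub>0" "complex_of_real z + 1/2 \<notin> \<int>\<^sub>\<le>\<^sub>0"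
    using assms of_real_in_nonpos_Ints_iff[of z, where ?'a = complex]
      of_real_in_nonpos_Ints_iff[of "z + 1/2", where ?'a = complex]
    by simp_all
  have "complex_of_real (Gamma z * Gamma (z + 1/2)) =
        complex_of_real (exp ((1 - 2 * z) * ln 2) * sqrt pi * Gamma (2 * z))"
  proof -
    have "Gamma (complex_of_real z) = of_real (Gamma z)"
      "Gamma (complex_of_real z + 1/2) = of_real (Gamma (z + 1/2))"
      "Gamma (2 * complex_of_real z) = of_real (Gamma (2 * z))"
      using Gamma_complex_of_real[of z] Gamma_complex_of_real[of "z + 1/2"]
        Gamma_complex_of_real[of "2 * z"] by simp_all
    moreover have "exp ((1 - 2 * complex_of_real z) * of_real (ln 2)) = of_real (exp ((1 - 2 * z) * ln 2))"
      using exp_of_real[of "(1 - 2 * z) * ln 2", where ?'a = complex] by simp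
    ultimately show ?thesis
      using Gamma_legendre_duplication[OF p] by (simp only: of_real_mult)
  qed
  then show ?thesis
    by (simp only: of_real_eq_iff) (simp add: powr_def)
qed

text \<open>
  The Beta value \<open>Gamma(a + 1/2)\<^sup>2 / Gamma(2 a + 1)\<close> is rewritten by the duplication formula so that
  \<open>a + 1/2\<close> no longer occurs. The factor \<open>a\<close> on the left absorbs the one in
  \<open>Gamma(2 a + 1) = 2 a Gamma(2 a)\<close>; the product \<open>a * L 1\<close> is what all later formulas contain.
\<close>

lemma gegenbauer_integral_one:
  assumes "a > - 1/2" "a \<noteq> 0"
  shows "a * gegenbauer_integral a (\<lambda>x. 1) = 2 * pi * Gamma (2 * a) / (2 powr (2 * a) * (Gamma a)\<^sup>2)"
proof -
  note poles = gegenbauer_parameter_poles[OF assms]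
  have G: "Gamma a \<noteq> 0" "Gamma (2 * a) \<noteq> 0"
    using poles by (simp_all add: Gamma_eq_zero_iff)
  have half: "Gamma (a + 1/2) = 2 / 2 powr (2 * a) * sqrt pi * Gamma (2 * a) / Gamma a"
    using Gamma_legendre_duplication_real[of a] poles G by (simp add: powr_diff field_simps)
  have "gegenbauer_integral a (\<lambda>x. 1) = 2 powr (2 * a) * Beta (a + 1/2) (a + 1/2)"
    unfolding gegenbauer_integral_def
    using weight_has_integral[OF assms(1)] by (simp add: integral_unique)
  also have "Beta (a + 1/2) (a + 1/2) = (Gamma (a + 1/2))\<^sup>2 / (2 * a * Gamma (2 * a))"
    using Gamma_plus1[OF poles(2)] by (simp add: Beta_def power2_eq_square)
  finally show ?thesis
    unfolding half using G assms by (simp add: field_simps power2_eq_square)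
qed

section \<open>Orthogonality\<close>

text \<open>
  The derivative of \<open>F(x) = (1 - x\<^sup>2) powr (a + 1/2) * C\<^sub>n(x)\<close> is
  \<open>((n - 1) x C\<^sub>n - (n + 1) C\<^bsub>n+1\<^esub>) w\<close>, and \<open>F\<close> vanishes at \<open>1\<close> and \<open>-1\<close> because
  \<open>a + 1/2 > 0\<close>. The weight may be singular at the end points, but \<open>F\<close> is continuous there, so the
  fundamental theorem applies with the derivative taken in the open interval only.
\<close>

lemma gegenbauer_integral_by_parts:
  assumes "a > - 1/2"
  shows "(real n + 1) * gegenbauer_integral a (gegenbauer (n + 1) a) =
         (real n - 1) * gegenbauer_integral a (\<lambda>x. x * gegenbauer n a x)"
proof -
  let ?w = "\<lambda>x::real. (1 - x\<^sup>2) powr (a - 1/2)"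
  let ?F = "\<lambda>x::real. (1 - x\<^sup>2) powr (a + 1/2) * gegenbauer n a x"
  let ?f = "\<lambda>x. (real n - 1) * (x * gegenbauer n a x) + - (real n + 1) * gegenbauer (n + 1) a x"
  have "((\<lambda>x. ?f x * ?w x) has_integral (?F 1 - ?F (- 1))) {-1..1}"
  proof (rule fundamental_theorem_of_calculus_interior)
    have "x\<^sup>2 \<le> 1" if "x \<in> {-1..1}" for x :: real
      using that by (simp add: abs_square_le_1 abs_le_iff)
    then show "continuous_on {-1..1} ?F"
      using assms by (intro continuous_intros continuous_on_powr') auto
  next
    fix x :: real
    assume "x \<in> {-1<..<1}"
    then have x: "\<bar>x\<bar> < 1" by auto
    then have pos: "1 - x\<^sup>2 > 0" by (simp add: abs_square_less_1)
    obtain D where D: "(gegenbauer n a has_real_derivative D) (at x)"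
      and E: "(1 - x\<^sup>2) * D = (real n + 2 * a) * (x * gegenbauer n a x)
                              - (real n + 1) * gegenbauer (n + 1) a x"
      using gegenbauer_has_derivative[OF x] by blast
    have p: "(1 - x\<^sup>2) powr (a + 1/2) = ?w x * (1 - x\<^sup>2)"
      using pos powr_add[of "1 - x\<^sup>2" "a - 1/2" 1] by (simp add: add_ac)
    have "((\<lambda>x. (1 - x\<^sup>2) powr (a + 1/2)) has_real_derivative - (2 * a + 1) * x * ?w x) (at x)"
    proof -
      have "((\<lambda>x. 1 - x\<^sup>2) has_real_derivative - 2 * x) (at x)"
        by (auto intro!: derivative_eq_intros)
      from DERIV_fun_powr[OF this pos, of "a + 1/2"] show ?thesis
        by (simp add: algebra_simps)
    qed
    from DERIV_mult[OF this D]
    have "(?F has_real_derivative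
        (- (2 * a + 1) * x * ?w x * gegenbauer n a x + D * (1 - x\<^sup>2) powr (a + 1/2))) (at x)"
      by simp
    also have "- (2 * a + 1) * x * ?w x * gegenbauer n a x + D * (1 - x\<^sup>2) powr (a + 1/2)
        = (- (2 * a + 1) * (x * gegenbauer n a x) + (1 - x\<^sup>2) * D) * ?w x"
      unfolding p by (simp add: algebra_simps)
    also have "\<dots> = ?f x * ?w x"
      unfolding E by (simp add: algebra_simps)
    finally show "(?F has_vector_derivative ?f x * ?w x) (at x)"
      by (simp add: has_real_derivative_iff_has_vector_derivative)
  qed simp
  then have "gegenbauer_integral a ?f = 0"
    unfolding gegenbauer_integral_def by (simp add: integral_unique)
  moreover have "gegenbauer_integral a ?f =
      (real n - 1) * gegenbauer_integral a (\<lambda>x. x * gegenbauer n a x)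
        + - (real n + 1) * gegenbauer_integral a (gegenbauer (n + 1) a)"
    using assms by (intro gegenbauer_integral_lincomb continuous_intros)
  ultimately show ?thesis by algebra
qed

lemma gegenbauer_integral_mult_x:
  assumes "a > - 1/2" "continuous_on {-1..1} g"
  shows "2 * (real n + 1 + a) * gegenbauer_integral a (\<lambda>x. x * gegenbauer (n + 1) a x * g x) =
     (real n + 2) * gegenbauer_integral a (\<lambda>x. gegenbauer (n + 2) a x * g x)
       + (real n + 2 * a) * gegenbauer_integral a (\<lambda>x. gegenbauer n a x * g x)"
proof -
  have "2 * (real n + 1 + a) * gegenbauer_integral a (\<lambda>x. x * gegenbauer (n + 1) a x * g x) =
      gegenbauer_integral a (\<lambda>x. 2 * (real n + 1 + a) * (x * gegenbauer (n + 1) a x * g x))"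
    by (simp add: gegenbauer_integral_cmult)
  also have "(\<lambda>x. 2 * (real n + 1 + a) * (x * gegenbauer (n + 1) a x * g x)) =
      (\<lambda>x. (real n + 2) * (gegenbauer (n + 2) a x * g x)
           + (real n + 2 * a) * (gegenbauer n a x * g x))"
  proof
    show "2 * (real n + 1 + a) * (x * gegenbauer (n + 1) a x * g x) =
       (real n + 2) * (gegenbauer (n + 2) a x * g x)
           + (real n + 2 * a) * (gegenbauer n a x * g x)" for x
      using mult_x_gegenbauer[of n a x] by algebra
  qed
  also have "gegenbauer_integral a \<dots> =
     (real n + 2) * gegenbauer_integral a (\<lambda>x. gegenbauer (n + 2) a x * g x)
       + (real n + 2 * a) * gegenbauer_integral a (\<lambda>x. gegenbauer n a x * g x)"
    using assms by (intro gegenbauer_integral_lincomb continuous_intros)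
  finally show ?thesis .
qed

text \<open>
  Integration by parts and the three-term recurrence are two linear relations between
  \<open>L C\<^bsub>n+1\<^esub>\<close>, \<open>L (x C\<^sub>n)\<close> and \<open>L C\<^bsub>n-1\<^esub>\<close>. When \<open>L C\<^bsub>n-1\<^esub> = 0\<close> they leave
  \<open>(n + 1 + 2 a) L (x C\<^sub>n) = 0\<close>, hence \<open>L C\<^bsub>n+1\<^esub> = 0\<close>. The induction starts at \<open>L C\<^sub>1\<close> and
  \<open>L C\<^sub>2\<close>, where integration by parts suffices; for \<open>C\<^sub>2\<close> its right-hand side has the factor
  \<open>n - 1 = 0\<close>.
\<close>

lemma gegenbauer_integral_eq_0:
  assumes "a > - 1/2"
  shows "gegenbauer_integral a (gegenbauer (n + 1) a) = 0"
proof (induction n rule: induct_nat_012)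
  case 0
  have "gegenbauer_integral a (gegenbauer 1 a) = 2 * a * gegenbauer_integral a (\<lambda>x. x)"
    unfolding gegenbauer_1 [abs_def] by (simp add: gegenbauer_integral_cmult)
  moreover have "gegenbauer_integral a (gegenbauer 1 a) = - gegenbauer_integral a (\<lambda>x. x)"
    using gegenbauer_integral_by_parts[OF assms, of 0] by simp
  ultimately have "(2 * a + 1) * gegenbauer_integral a (\<lambda>x. x) = 0"
    by (simp add: algebra_simps)
  then have "gegenbauer_integral a (\<lambda>x. x) = 0" using assms by simp
  then have "gegenbauer_integral a (gegenbauer 1 a) = 0"
    using \<open>gegenbauer_integral a (gegenbauer 1 a) = - gegenbauer_integral a (\<lambda>x. x)\<close> by linarith
  then show ?case by (simp only: add_0)
next
  case 1
  show ?case using gegenbauer_integral_by_parts[OF assms, of 1] by simp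
next
  case (ge2 n)
  let ?L = "\<lambda>k. gegenbauer_integral a (gegenbauer k a)"
  let ?M = "gegenbauer_integral a (\<lambda>x. x * gegenbauer (n + 2) a x)"
  have "(real n + 3) * ?L (n + 3) = (real n + 1) * ?M"
    using gegenbauer_integral_by_parts[OF assms, of "n + 2"]
    by (simp add: numeral_3_eq_3 algebra_simps)
  moreover have "2 * (real n + 2 + a) * ?M = (real n + 3) * ?L (n + 3)"
    using gegenbauer_integral_mult_x[OF assms, of "\<lambda>x. 1" "n + 1"] ge2
    by (simp add: numeral_3_eq_3 algebra_simps)
  ultimately have "(real n + 3 + 2 * a) * ?M = 0"
    by (simp add: algebra_simps)
  then have "?M = 0" using assms by auto
  with \<open>(real n + 3) * ?L (n + 3) = (real n + 1) * ?M\<close> have "?L (n + 3) = 0"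
    by (simp add: add_eq_0_iff)
  then show ?case by (simp add: numeral_3_eq_3)
qed

text \<open>
  Induction on the smaller index: the recurrence in \<open>m\<close> expresses \<open>C\<^bsub>m+2\<^esub>\<close> through
  \<open>x C\<^bsub>m+1\<^esub>\<close> and \<open>C\<^sub>m\<close>, and in \<open>L (x C\<^bsub>m+1\<^esub> C\<^sub>n)\<close> the factor \<open>x\<close> is moved to \<open>C\<^sub>n\<close>, which
  changes \<open>n\<close> by one only and so keeps it above \<open>m + 1\<close>.
\<close>

lemma gegenbauer_orthogonal:
  assumes "a > - 1/2" "a \<noteq> 0" "m < n"
  shows "gegenbauer_integral a (\<lambda>x. gegenbauer m a x * gegenbauer n a x) = 0"
  using \<open>m < n\<close>
proof (induction m arbitrary: n rule: induct_nat_012)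
  case 0
  then show ?case
    using gegenbauer_integral_eq_0[OF assms(1), of "n - 1"] by simp
next
  case 1
  then obtain k where n: "n = k + 2" using less_imp_Suc_add[of 1 n] by auto
  have "gegenbauer_integral a (\<lambda>x. gegenbauer 1 a x * gegenbauer n a x)
      = 2 * a * gegenbauer_integral a (\<lambda>x. x * gegenbauer n a x)"
    unfolding gegenbauer_1 [abs_def] by (simp add: gegenbauer_integral_cmult mult.assoc)
  moreover have "2 * (real k + 2 + a) * gegenbauer_integral a (\<lambda>x. x * gegenbauer n a x) = 0"
    using gegenbauer_integral_mult_x[OF assms(1), of "\<lambda>x. 1" "k + 1"]
      gegenbauer_integral_eq_0[OF assms(1), of "k + 2"]
      gegenbauer_integral_eq_0[OF assms(1), of k] n
    by (simp add: algebra_simps)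
  ultimately show ?case using assms by auto
next
  case (ge2 m)
  let ?L = "\<lambda>m n. gegenbauer_integral a (\<lambda>x. gegenbauer m a x * gegenbauer n a x)"
  let ?M = "gegenbauer_integral a (\<lambda>x. x * gegenbauer (m + 1) a x * gegenbauer n a x)"
  from ge2.prems obtain k where n: "n = k + 1" "m + 1 < k"
    by (cases n) auto
  have "2 * (real k + 1 + a) * gegenbauer_integral a
        (\<lambda>x. x * gegenbauer (k + 1) a x * gegenbauer (m + 1) a x) =
      (real k + 2) * ?L (m + 1) (k + 2) + (real k + 2 * a) * ?L (m + 1) k"
    using gegenbauer_integral_mult_x[OF assms(1) continuous_on_gegenbauer, of k "m + 1" a]
    by (simp only: mult.commute[of _ "gegenbauer (m + 1) a _"])
  then have "2 * (real k + 1 + a) * ?M = 0"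
    using ge2.IH(2)[of "k + 2"] ge2.IH(2)[of k] n by (simp add: mult.assoc mult.left_commute mult.commute)
  then have "?M = 0" using assms n by auto
  then have "(real m + 2) * ?L (m + 2) n = 0"
    using gegenbauer_integral_mult_x[OF assms(1) continuous_on_gegenbauer, of m n a]
      ge2.IH(1)[of n] n by simp
  then have "?L (m + 2) n = 0" by (simp add: add_eq_0_iff)
  then show ?case by simp
qed

text \<open>
  Evaluate \<open>L (x C\<^bsub>n+1\<^esub> C\<^sub>n)\<close> twice: expanding \<open>x C\<^bsub>n+1\<^esub>\<close> by the recurrence leaves a multiple of
  \<open>h\<^sub>n\<close>, expanding \<open>x C\<^sub>n\<close> leaves a multiple of \<open>h\<^bsub>n+1\<^esub>\<close>.
\<close>

lemma gegenbauer_norm_rec: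
  assumes "a > - 1/2" "a \<noteq> 0"
  shows "(real n + 1) * (real n + 1 + a) * gegenbauer_integral a (\<lambda>x. (gegenbauer (n + 1) a x)\<^sup>2) =
         (real n + a) * (real n + 2 * a) * gegenbauer_integral a (\<lambda>x. (gegenbauer n a x)\<^sup>2)"
proof -
  let ?L = "\<lambda>m n. gegenbauer_integral a (\<lambda>x. gegenbauer m a x * gegenbauer n a x)"
  let ?M = "gegenbauer_integral a (\<lambda>x. x * gegenbauer (n + 1) a x * gegenbauer n a x)"
  have up: "2 * (real n + 1 + a) * ?M = (real n + 2 * a) * ?L n n"
    using gegenbauer_integral_mult_x[OF assms(1) continuous_on_gegenbauer, of n n a]
      gegenbauer_orthogonal[OF assms, of n "n + 2"]
    by (simp add: mult.commute)
  have down: "2 * (real n + a) * ?M = (real n + 1) * ?L (n + 1) (n + 1)"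
  proof (cases n)
    case 0
    \<comment> \<open>Here \<open>x C\<^sub>0\<close> is a multiple of \<open>C\<^sub>1\<close> by the definition of \<open>C\<^sub>1\<close>, without the recurrence.\<close>
    have "?L 1 1 = 2 * a * ?M"
      unfolding 0 gegenbauer_integral_cmult[symmetric] by (simp add: mult_ac)
    with 0 show ?thesis by simp
  next
    case (Suc k)
    have "2 * (real k + 1 + a) *
        gegenbauer_integral a (\<lambda>x. x * gegenbauer (k + 1) a x * gegenbauer (k + 2) a x)
        = (real k + 2) * ?L (k + 2) (k + 2)"
      using gegenbauer_integral_mult_x[OF assms(1) continuous_on_gegenbauer, of k "k + 2" a]
        gegenbauer_orthogonal[OF assms, of k "k + 2"] by simp
    then show ?thesis using Suc by (simp add: mult_ac add_ac)
  qed
  show ?thesis unfolding power2_eq_square using up down by algebra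
qed

lemma gegenbauer_norm:
  assumes "a > - 1/2" "a \<noteq> 0"
  shows "gegenbauer_integral a (\<lambda>x. (gegenbauer n a x)\<^sup>2) =
         a * gegenbauer_integral a (\<lambda>x. 1) * pochhammer (2 * a) n / ((real n + a) * fact n)"
proof (induction n)
  case 0
  then show ?case using assms by simp
next
  case (Suc n)
  have nz: "real n + 1 + a \<noteq> 0" "real n + a \<noteq> 0"
    using assms by (auto, cases n, auto)
  have "(real n + 1) * (real n + 1 + a) * gegenbauer_integral a (\<lambda>x. (gegenbauer (n + 1) a x)\<^sup>2) =
      (real n + 2 * a) * (a * gegenbauer_integral a (\<lambda>x. 1)) * pochhammer (2 * a) n / fact n"
    unfolding gegenbauer_norm_rec[OF assms, of n] Suc using nz by (simp add: divide_simps)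
  moreover have "h = K * (p * (2 * a + r)) / (t * (s * F))"
    if "s * t * h = (r + 2 * a) * K * p / F" "s \<noteq> 0" "t \<noteq> 0" "F \<noteq> 0" for h s t r K p F :: real
    using that by (simp add: field_simps)
  ultimately show ?case
    using nz by (simp add: pochhammer_Suc add_ac)
qed

section \<open>The divided difference at the origin\<close>

text \<open>
  The polynomial \<open>(C\<^sub>n(x) - C\<^sub>n(0)) / x\<close>. The recursion gives it its right value at \<open>x = 0\<close> and
  exhibits it as a combination of \<open>C\<^bsub>n-1\<^esub>, C\<^bsub>n-3\<^esub>, \<dots>\<close>.
\<close>

fun gegenbauer_quotient :: "nat \<Rightarrow> real \<Rightarrow> real \<Rightarrow> real" where
  "gegenbauer_quotient 0 a x = 0"
| "gegenbauer_quotient (Suc 0) a x = 2 * a"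
| "gegenbauer_quotient (Suc (Suc n)) a x =
     (2 * (real n + 1 + a) * gegenbauer (n + 1) a x - (real n + 2 * a) * gegenbauer_quotient n a x)
       / (real n + 2)"

lemma gegenbauer_quotient_rec:
  "(real n + 2) * gegenbauer_quotient (n + 2) a x =
     2 * (real n + 1 + a) * gegenbauer (n + 1) a x - (real n + 2 * a) * gegenbauer_quotient n a x"
  by simp

lemma mult_x_gegenbauer_quotient:
  "x * gegenbauer_quotient n a x = gegenbauer n a x - gegenbauer n a 0"
proof (induction n rule: induct_nat_012)
  case (ge2 n)
  have "(real n + 2) * (x * gegenbauer_quotient (n + 2) a x) =
     2 * (real n + 1 + a) * x * gegenbauer (n + 1) a x
       - (real n + 2 * a) * (x * gegenbauer_quotient n a x)"
    using gegenbauer_quotient_rec[of n a x] by algebra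
  also have "\<dots> = (real n + 2) * (gegenbauer (n + 2) a x - gegenbauer (n + 2) a 0)"
    unfolding ge2 using gegenbauer_rec[of n a x] gegenbauer_rec[of n a 0] by algebra
  finally have "x * gegenbauer_quotient (n + 2) a x = gegenbauer (n + 2) a x - gegenbauer (n + 2) a 0"
    by (subst (asm) mult_cancel_left) auto
  then show ?case by simp
qed auto

lemma continuous_on_gegenbauer_quotient [continuous_intros]:
  "continuous_on S (gegenbauer_quotient n a)"
proof (induction n rule: induct_nat_012)
  case (ge2 n)
  then show ?case unfolding gegenbauer_quotient.simps(3) [abs_def]
    by (intro continuous_intros) auto
qed (auto intro!: continuous_intros)

lemma gegenbauer_gamma_eq:
  "gegenbauer_gamma n a = gegenbauer_integral a (\<lambda>x. (gegenbauer_quotient n a x)\<^sup>2)"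
  unfolding gegenbauer_gamma_def gegenbauer_integral_def
proof (rule integral_spike[of "{0}"])
  show "(gegenbauer_quotient n a x)\<^sup>2 * (1 - x\<^sup>2) powr (a - 1/2) =
      ((gegenbauer n a x - gegenbauer n a 0) / x)\<^sup>2 * (1 - x\<^sup>2) powr (a - 1/2)"
    if "x \<in> {-1..1} - {0}" for x
    using that by (simp add: mult_x_gegenbauer_quotient [symmetric])
qed simp

text \<open>
  The index \<open>m = n\<close> is included because the quotient lowers the degree by one.
\<close>

lemma gegenbauer_quotient_orthogonal:
  assumes "a > - 1/2" "a \<noteq> 0" "m \<le> n"
  shows "gegenbauer_integral a (\<lambda>x. gegenbauer_quotient m a x * gegenbauer n a x) = 0"
  using \<open>m \<le> n\<close>
proof (induction m rule: induct_nat_012)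
  case 0
  show ?case by (simp add: gegenbauer_integral_def)
next
  case 1
  then show ?case
    using gegenbauer_integral_eq_0[OF assms(1), of "n - 1"]
    by (simp add: gegenbauer_integral_cmult)
next
  case (ge2 m)
  have "(real m + 2) * gegenbauer_integral a (\<lambda>x. gegenbauer_quotient (m + 2) a x * gegenbauer n a x)
    = gegenbauer_integral a (\<lambda>x. (real m + 2) * (gegenbauer_quotient (m + 2) a x * gegenbauer n a x))"
    by (simp only: gegenbauer_integral_cmult)
  also have "\<dots> = gegenbauer_integral a (\<lambda>x.
        2 * (real m + 1 + a) * (gegenbauer (m + 1) a x * gegenbauer n a x)
        + - (real m + 2 * a) * (gegenbauer_quotient m a x * gegenbauer n a x))"
  proof (intro arg_cong[where f = "gegenbauer_integral a"] ext)
    show "(real m + 2) * (gegenbauer_quotient (m + 2) a x * gegenbauer n a x) =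
        2 * (real m + 1 + a) * (gegenbauer (m + 1) a x * gegenbauer n a x)
        + - (real m + 2 * a) * (gegenbauer_quotient m a x * gegenbauer n a x)" for x
      using gegenbauer_quotient_rec[of m a x] by algebra
  qed
  also have "\<dots> = 2 * (real m + 1 + a) *
        gegenbauer_integral a (\<lambda>x. gegenbauer (m + 1) a x * gegenbauer n a x)
      + - (real m + 2 * a) *
        gegenbauer_integral a (\<lambda>x. gegenbauer_quotient m a x * gegenbauer n a x)"
    using assms by (intro gegenbauer_integral_lincomb continuous_intros)
  also have "\<dots> = 0"
    using gegenbauer_orthogonal[OF assms(1,2), of "m + 1" n] ge2 by simp
  finally show ?case by (simp add: add_eq_0_iff)
qed

lemma gegenbauer_gamma_rec:
  assumes "a > - 1/2" "a \<noteq> 0"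
  shows "(real n + 2)\<^sup>2 * gegenbauer_gamma (n + 2) a =
     4 * (real n + 1 + a)\<^sup>2 * gegenbauer_integral a (\<lambda>x. (gegenbauer (n + 1) a x)\<^sup>2)
       + (real n + 2 * a)\<^sup>2 * gegenbauer_gamma n a"
proof -
  \<comment> \<open>Expand the square of the recurrence for the quotients; the mixed term integrates to \<open>0\<close>.\<close>
  let ?C = "\<lambda>x. gegenbauer (n + 1) a x" and ?q = "\<lambda>x. gegenbauer_quotient n a x"
  let ?s = "2 * (real n + 1 + a)" and ?t = "real n + 2 * a"
  have "(real n + 2)\<^sup>2 * gegenbauer_gamma (n + 2) a =
      gegenbauer_integral a (\<lambda>x. (real n + 2)\<^sup>2 * (gegenbauer_quotient (n + 2) a x)\<^sup>2)"
    by (simp only: gegenbauer_gamma_eq gegenbauer_integral_cmult)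
  also have "(\<lambda>x. (real n + 2)\<^sup>2 * (gegenbauer_quotient (n + 2) a x)\<^sup>2) =
      (\<lambda>x. 1 * (?s\<^sup>2 * (?C x)\<^sup>2 + ?t\<^sup>2 * (?q x)\<^sup>2) + (- 2 * ?s * ?t) * (?q x * ?C x))"
  proof
    fix x
    have "(real n + 2)\<^sup>2 * (gegenbauer_quotient (n + 2) a x)\<^sup>2 = (?s * ?C x - ?t * ?q x)\<^sup>2"
      by (simp only: power_mult_distrib [symmetric] gegenbauer_quotient_rec)
    then show "(real n + 2)\<^sup>2 * (gegenbauer_quotient (n + 2) a x)\<^sup>2 =
        1 * (?s\<^sup>2 * (?C x)\<^sup>2 + ?t\<^sup>2 * (?q x)\<^sup>2) + (- 2 * ?s * ?t) * (?q x * ?C x)"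
      by algebra
  qed
  also have "gegenbauer_integral a \<dots> =
      1 * gegenbauer_integral a (\<lambda>x. ?s\<^sup>2 * (?C x)\<^sup>2 + ?t\<^sup>2 * (?q x)\<^sup>2)
      + (- 2 * ?s * ?t) * gegenbauer_integral a (\<lambda>x. ?q x * ?C x)"
    using assms by (intro gegenbauer_integral_lincomb continuous_intros)
  also have "gegenbauer_integral a (\<lambda>x. ?q x * ?C x) = 0"
    using gegenbauer_quotient_orthogonal[OF assms, of n "n + 1"] by simp
  also have "gegenbauer_integral a (\<lambda>x. ?s\<^sup>2 * (?C x)\<^sup>2 + ?t\<^sup>2 * (?q x)\<^sup>2) =
      ?s\<^sup>2 * gegenbauer_integral a (\<lambda>x. (?C x)\<^sup>2) + ?t\<^sup>2 * gegenbauer_integral a (\<lambda>x. (?q x)\<^sup>2)"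
    using assms by (intro gegenbauer_integral_lincomb continuous_intros)
  finally have "(real n + 2)\<^sup>2 * gegenbauer_gamma (n + 2) a =
      ?s\<^sup>2 * gegenbauer_integral a (\<lambda>x. (?C x)\<^sup>2) + ?t\<^sup>2 * gegenbauer_gamma n a"
    by (simp add: gegenbauer_gamma_eq)
  moreover have "?s\<^sup>2 = 4 * (real n + 1 + a)\<^sup>2"
    by (simp only: power_mult_distrib) simp
  ultimately show ?thesis by (simp only:)
qed

lemma gegenbauer_gamma_rec_explicit:
  assumes "a > - 1/2" "a \<noteq> 0"
  shows "(real n + 2)\<^sup>2 * gegenbauer_gamma (n + 2) a =
     4 * (real n + 1 + a) * (a * gegenbauer_integral a (\<lambda>x. 1)) * pochhammer (2 * a) (n + 1)
       / fact (n + 1)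
     + (real n + 2 * a)\<^sup>2 * gegenbauer_gamma n a"
proof -
  have *: "4 * z\<^sup>2 * (A * p / (z * F)) = 4 * z * A * p / F" if "z \<noteq> 0" for z A p F :: real
    using that by (simp add: power2_eq_square)
  have nz: "real (n + 1) + a \<noteq> 0" using assms by auto
  have z: "real n + 1 + a = real (n + 1) + a" by simp
  have "4 * (real n + 1 + a)\<^sup>2 * gegenbauer_integral a (\<lambda>x. (gegenbauer (n + 1) a x)\<^sup>2) =
      4 * (real n + 1 + a) * (a * gegenbauer_integral a (\<lambda>x. 1)) * pochhammer (2 * a) (n + 1)
       / fact (n + 1)"
    unfolding gegenbauer_norm[OF assms] z by (rule *[OF nz])
  then show ?thesis using gegenbauer_gamma_rec[OF assms, of n] by simp
qed

section \<open>Closed forms\<close>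

lemma gegenbauer_gamma_odd:
  assumes "a > - 1/2" "a \<noteq> 0"
  shows "gegenbauer_gamma (2 * n + 1) a =
    2 * (a * gegenbauer_integral a (\<lambda>x. 1)) * pochhammer (2 * a) (2 * n + 1) / fact (2 * n + 1)"
proof (induction n)
  case 0
  have "gegenbauer_gamma 1 a = gegenbauer_integral a (\<lambda>x. (2 * a)\<^sup>2 * 1)"
    by (simp add: gegenbauer_gamma_eq)
  also have "\<dots> = (2 * a)\<^sup>2 * gegenbauer_integral a (\<lambda>x. 1)"
    by (rule gegenbauer_integral_cmult)
  finally show ?case by (simp add: power2_eq_square)
next
  case (Suc n)
  define N where "N = 2 * n + 1"
  define K where "K = a * gegenbauer_integral a (\<lambda>x. 1)"
  have N2: "real N + 2 \<noteq> 0" by linarith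
  have IH: "gegenbauer_gamma N a = 2 * K * pochhammer (2 * a) N / fact N"
    using Suc unfolding N_def K_def .
  have "(real N + 2)\<^sup>2 * gegenbauer_gamma (N + 2) a =
     4 * (real N + 1 + a) * K * pochhammer (2 * a) (N + 1) / fact (N + 1)
     + (real N + 2 * a)\<^sup>2 * (2 * K * pochhammer (2 * a) N / fact N)"
    using gegenbauer_gamma_rec_explicit[OF assms, of N] unfolding IH K_def .
  also have "\<dots> = (real N + 2)\<^sup>2 * (2 * K * pochhammer (2 * a) (N + 2) / fact (N + 2))"
  proof -
    have f: "fact (N + 1) = (real N + 1) * fact N"
       "fact (N + 2) = (real N + 2) * ((real N + 1) * fact N)"
      by (simp_all add: algebra_simps)
    have p: "pochhammer (2 * a) (N + 1) = pochhammer (2 * a) N * (2 * a + real N)"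
       "pochhammer (2 * a) (N + 2) = pochhammer (2 * a) N * (2 * a + real N) * (2 * a + real N + 1)"
      by (simp_all add: pochhammer_Suc algebra_simps)
    have "real N + 1 \<noteq> 0" "real N + 2 \<noteq> 0" by linarith+
    then show ?thesis unfolding f p
      by (simp add: divide_simps) algebra
  qed
  finally have "gegenbauer_gamma (N + 2) a = 2 * K * pochhammer (2 * a) (N + 2) / fact (N + 2)"
    by (metis mult_cancel_left power_not_zero N2)
  then show ?case by (simp add: N_def K_def)
qed

text \<open>
  For \<open>\<gamma>\<^bsub>2n\<^esub> = 4 a L(1) (a)\<^sub>n X\<^sub>n(a) / (2 n)!\<close> this is the recurrence of \<open>\<gamma>\<close> divided by common factors. Both
  parts of \<open>X\<^sub>n(a)\<close> are involved: the binomial part solves the homogeneous equation, by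
  \<open>(n + 1) \<beta>\<^bsub>n+1\<^esub> = 2 (2 n + 1) \<beta>\<^sub>n\<close> for \<open>\<beta>\<^sub>n = (2 n - 1) choose (n - 1)\<close>, and the part with
  \<open>(a + 1/2)\<^sub>n\<close> accounts for the inhomogeneity.
\<close>

lemma gegenbauer_X_rec:
  assumes "n \<ge> 1"
  shows "(2 * real n + 2) * gegenbauer_X (n + 1) a =
     (2 * real n + 1 + a) * 2 ^ (2 * n + 1) * pochhammer (a + 1/2) n
       + 4 * (real n + a) * (2 * real n + 1) * gegenbauer_X n a"
proof -
  have B: "(real n + 1) * real ((2 * n + 1) choose n) =
           2 * (2 * real n + 1) * real ((2 * n - 1) choose (n - 1))"
  proof -
    \<comment> \<open>With \<open>n = k + 1\<close>, pass from \<open>(2 k + 1) choose k\<close> through the central coefficient to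
      \<open>(2 k + 3) choose (k + 1)\<close>; the shift keeps truncated subtraction out.\<close>
    obtain k where k: "n = Suc k" using assms by (cases n) auto
    have 1: "(k + 1) * ((2 * k + 2) choose (k + 1)) = (2 * k + 2) * ((2 * k + 1) choose k)"
      using Suc_times_binomial_eq[of "2 * k + 1" k] by (simp add: mult.commute)
    have 2: "(k + 2) * ((2 * k + 3) choose (k + 1)) = (2 * k + 3) * ((2 * k + 2) choose (k + 1))"
      using binomial_absorb_comp[of "2 * k + 3" "k + 1"] by (simp add: numeral_3_eq_3 numeral_2_eq_2)
    from 1 have "(k + 1) * ((2 * k + 2) choose (k + 1)) = (k + 1) * (2 * ((2 * k + 1) choose k))"
      by (simp add: algebra_simps)
    then have "(2 * k + 2) choose (k + 1) = 2 * ((2 * k + 1) choose k)"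
      by (simp only: mult_cancel1) simp
    with 2 have "(k + 2) * ((2 * k + 3) choose (k + 1)) = (2 * k + 3) * (2 * ((2 * k + 1) choose k))"
      by (simp only:)
    then have "real ((k + 2) * ((2 * k + 3) choose (k + 1)))
        = real ((2 * k + 3) * (2 * ((2 * k + 1) choose k)))"
      by (simp only:)
    then have "(real k + 2) * real ((2 * k + 3) choose (k + 1))
        = (2 * real k + 3) * (2 * real ((2 * k + 1) choose k))"
      by (simp only: of_nat_mult of_nat_add of_nat_numeral)
    moreover have "2 * n + 1 = 2 * k + 3" "2 * n - 1 = 2 * k + 1" "n - 1 = k" "n = k + 1"
      "real n + 1 = real k + 2" "2 * real n + 1 = 2 * real k + 3"
      by (simp_all add: k)
    ultimately show ?thesis by (simp only: mult.commute mult.left_commute)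
  qed
  define P where "P = pochhammer (a + 1/2) n"
  define Q where "Q = pochhammer a n"
  define T where "T = (2::real) ^ (2 * n - 1)"
  have T: "2 ^ (2 * n + 1) = 4 * T"
    using assms by (cases n) (auto simp: T_def)
  define b where "b = real ((2 * n - 1) choose (n - 1))"
  define c where "c = real ((2 * n + 1) choose n)"
  have X: "gegenbauer_X n a = T * P - b * Q"
    by (simp add: gegenbauer_X_def T_def P_def Q_def b_def)
  have X': "gegenbauer_X (n + 1) a = 4 * T * (P * (a + 1/2 + real n)) - c * (Q * (a + real n))"
    using T by (simp add: gegenbauer_X_def P_def Q_def c_def pochhammer_Suc)
  have c: "(real n + 1) * c = 2 * (2 * real n + 1) * b"
    using B unfolding b_def c_def .
  have "(2 * real n + 2) * gegenbauer_X (n + 1) a =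
      4 * T * ((2 * real n + 2) * (P * (a + 1/2 + real n)))
        - 2 * ((real n + 1) * c) * (Q * (a + real n))"
    unfolding X' by (simp add: algebra_simps)
  also have "\<dots> = (2 * real n + 1 + a) * (4 * T) * P + 4 * (real n + a) * (2 * real n + 1) * (T * P - b * Q)"
    unfolding c by (simp add: algebra_simps)
  finally show ?thesis unfolding X T P_def .
qed

text \<open>
  The norm \<open>h\<^bsub>2n+1\<^esub>\<close> contains \<open>(2 a)\<^bsub>2n+1\<^esub>\<close>, which the duplication formula for Pochhammer symbols
  splits into \<open>(a)\<^bsub>n+1\<^esub>\<close> and \<open>(a + 1/2)\<^sub>n\<close>. The former is the common factor of the closed form,
  the latter the inhomogeneity in the recurrence of \<open>X\<^sub>n(a)\<close>.
\<close>

lemma gegenbauer_gamma_even: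
  assumes "a > - 1/2" "a \<noteq> 0" "n \<ge> 1"
  shows "gegenbauer_gamma (2 * n) a =
    4 * (a * gegenbauer_integral a (\<lambda>x. 1)) * pochhammer a n / fact (2 * n) * gegenbauer_X n a"
  using \<open>n \<ge> 1\<close>
proof (induction n rule: dec_induct)
  case base
  \<comment> \<open>The recurrence starts from \<open>\<gamma>\<^sub>0 = 0\<close>.\<close>
  have g0: "gegenbauer_gamma 0 a = 0"
    by (simp add: gegenbauer_gamma_eq gegenbauer_integral_def)
  have "(real 0 + 2)\<^sup>2 * gegenbauer_gamma 2 a =
     4 * (real 0 + 1 + a) * (a * gegenbauer_integral a (\<lambda>x. 1)) * pochhammer (2 * a) 1 / fact 1
     + (real 0 + 2 * a)\<^sup>2 * gegenbauer_gamma 0 a"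
    using gegenbauer_gamma_rec_explicit[OF assms(1,2), of 0] unfolding add_0 .
  then show ?case unfolding mult_1_right
    by (simp add: g0 gegenbauer_X_def algebra_simps fact_2)
next
  case (step n)
  define K where "K = a * gegenbauer_integral a (\<lambda>x. 1)"
  define P where "P = pochhammer (a + 1/2) n"
  define Q where "Q = pochhammer a n"
  define X where "X = gegenbauer_X n a"
  define F where "F = (fact (2 * n) :: real)"
  have F: "F \<noteq> 0" by (simp add: F_def)
  have IH: "gegenbauer_gamma (2 * n) a = 4 * K * Q / F * X"
    using step.IH unfolding K_def Q_def F_def X_def .
  have f1: "fact (2 * n + 1) = (2 * real n + 1) * F"
    by (simp add: F_def)
  have f2: "fact (2 * n + 2) = (2 * real n + 2) * ((2 * real n + 1) * F)"
    by (simp add: F_def algebra_simps)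
  have p: "pochhammer (2 * a) (2 * n + 1) = 2 ^ (2 * n) * Q * P * (2 * a + 2 * real n)"
    using pochhammer_double[of a n] by (simp add: pochhammer_Suc P_def Q_def)
  have nz: "2 * real n + 1 \<noteq> 0" "2 * real n + 2 \<noteq> 0" by linarith+
  have "(2 * real n + 2)\<^sup>2 * gegenbauer_gamma (2 * n + 2) a =
     4 * (2 * real n + 1 + a) * K * (2 ^ (2 * n) * Q * P * (2 * a + 2 * real n))
        / ((2 * real n + 1) * F)
     + (2 * real n + 2 * a)\<^sup>2 * (4 * K * Q / F * X)"
    using gegenbauer_gamma_rec_explicit[OF assms(1,2), of "2 * n"] unfolding IH f1 p K_def by simp
  also have "\<dots> = 4 * K * Q * (a + real n) / ((2 * real n + 1) * F) *
     ((2 * real n + 1 + a) * 2 ^ (2 * n + 1) * P + 4 * (real n + a) * (2 * real n + 1) * X)"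
    using nz F by (simp add: divide_simps) algebra
  also have "\<dots> = 4 * K * Q * (a + real n) / ((2 * real n + 1) * F) *
     ((2 * real n + 2) * gegenbauer_X (n + 1) a)"
    using gegenbauer_X_rec[of n a] step.hyps unfolding P_def X_def by simp
  also have "\<dots> = (2 * real n + 2)\<^sup>2 *
      (4 * K * (Q * (a + real n)) / ((2 * real n + 2) * ((2 * real n + 1) * F)) * gegenbauer_X (n + 1) a)"
    using nz F by (simp add: divide_simps) algebra
  finally have "gegenbauer_gamma (2 * n + 2) a = 
      4 * K * (Q * (a + real n)) / ((2 * real n + 2) * ((2 * real n + 1) * F)) * gegenbauer_X (n + 1) a"
    using nz(2) by (metis mult_cancel_left power_not_zero)
  then show ?case
    unfolding f2 [symmetric] by (simp add: K_def Q_def pochhammer_Suc)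
qed

theorem theorem1p6:
  fixes a :: real
  assumes "a > - 1/2" and "a \<noteq> 0"
  shows "(\<forall>n::nat. gegenbauer_gamma (2 * n + 1) a =
            pi * Gamma (2 * a + 2 * real n + 1)
              / (2 powr (2 * a - 2) * fact (2 * n + 1) * (Gamma a)\<^sup>2))
       \<and> (\<forall>n::nat. n \<ge> 1 \<longrightarrow> gegenbauer_gamma (2 * n) a =
            pi * Gamma (2 * a) * Gamma (a + real n)
              / (2 powr (2 * a - 3) * Gamma (2 * real n + 1) * (Gamma a) ^ 3)
              * gegenbauer_X n a)"
proof (intro conjI allI impI)
  note poles = gegenbauer_parameter_poles[OF assms]
  have G: "Gamma a \<noteq> 0" "Gamma (2 * a) \<noteq> 0"
    using poles by (simp_all add: Gamma_eq_zero_iff)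
  note K = gegenbauer_integral_one[OF assms]
  fix n :: nat
  have "pochhammer (2 * a) (2 * n + 1) = Gamma (2 * a + 2 * real n + 1) / Gamma (2 * a)"
    using pochhammer_Gamma[OF poles(2), of "2 * n + 1"] by (simp add: add_ac)
  then show "gegenbauer_gamma (2 * n + 1) a =
      pi * Gamma (2 * a + 2 * real n + 1)
        / (2 powr (2 * a - 2) * fact (2 * n + 1) * (Gamma a)\<^sup>2)"
    unfolding gegenbauer_gamma_odd[OF assms] K using G
    by (simp add: powr_diff field_simps del: fact_Suc)
  assume n: "n \<ge> 1"
  have "Gamma (2 * real n + 1) = fact (2 * n)"
    using Gamma_fact[of "2 * n", where ?'a = real] by (simp add: add_ac)
  then show "gegenbauer_gamma (2 * n) a =
      pi * Gamma (2 * a) * Gamma (a + real n)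
        / (2 powr (2 * a - 3) * Gamma (2 * real n + 1) * (Gamma a) ^ 3) * gegenbauer_X n a"
    unfolding gegenbauer_gamma_even[OF assms n] K pochhammer_Gamma[OF poles(1)] using G
    by (simp add: powr_diff field_simps power2_eq_square power3_eq_cube)
qed

end
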